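(* Assume that $\Theta^*:=\{\theta\in\Theta:\Phi(\theta)=\min_{\Theta}\Phi\}$, the set of minimizers of $\Phi$ on $\Theta$, is compact and non-empty. Let $(\hat\theta_n)_{n\ge 1}$ be a sequence of random variables with values in $\Theta$ such that, with probability $1$, $\hat\theta_n$ is a minimizer of $\Phi_n$ on $\Theta$ for all large enough $n$. Then $\mathrm{d}(\hat\theta_n,\Theta^* )\to 0$ almost surely as $n\to\infty$.
   Context: All random variables are defined on a fixed probability space $(\Omega,\mathcal F,\mathbb P)$. $X_1,X_2,\ldots$ are iid random variables with values in a measurable space $E$, with distribution $P$. $\Theta_0\subseteq\mathbb R^d$ is a fixed open convex set and $\Theta$ is a closed convex subset of $\Theta_0$. The loss $\phi:E\times\Theta_0\to\mathbb R$ is measurable in its first argument, convex in its second argument, and $\phi(\cdot,\theta)\in L^1(P)$ for all $\theta\in\Theta_0$. For $\theta\in\Theta_0$ and $n\ge1$, $\Phi(\theta)=\mathbb E[\phi(X_1,\theta)]$ and $\Phi_n(\theta)=\frac1n\sum_{i=1}^n\phi(X_i,\theta)$. $\mathrm{d}(x,A)$ denotes the Euclidean distance from $x$ to the set $A$. *)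

theory Defs
  imports "HOL-Probability.Probability"
begin

definition argmin_on :: "('a \<Rightarrow> real) \<Rightarrow> 'a set \<Rightarrow> 'a set" where
  "argmin_on f S = {x. is_arg_min f (\<lambda>y. y \<in> S) x}"

(* Sequences are indexed by n \<ge> 1; the entries X 0 and \<theta> 0 are junk and never used. *)

definition population_risk ::
    "'w measure \<Rightarrow> (nat \<Rightarrow> 'w \<Rightarrow> 'e) \<Rightarrow> ('e \<Rightarrow> 'a \<Rightarrow> real) \<Rightarrow> 'a \<Rightarrow> real" where
  "population_risk M X \<phi> \<theta> = (\<integral>\<omega>. \<phi> (X 1 \<omega>) \<theta> \<partial>M)"

definition empirical_risk ::
    "(nat \<Rightarrow> 'w \<Rightarrow> 'e) \<Rightarrow> ('e \<Rightarrow> 'a \<Rightarrow> real) \<Rightarrow> nat \<Rightarrow> 'w \<Rightarrow> 'a \<Rightarrow> real" where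
  "empirical_risk X \<phi> n \<omega> \<theta> = 1 / real n * (\<Sum>i=1..n. \<phi> (X i \<omega>) \<theta>)"

(* Measurability of each X i is part of prob_space.indep_vars. *)

definition iid_with_law ::
    "'w measure \<Rightarrow> 'e measure \<Rightarrow> 'e measure \<Rightarrow> (nat \<Rightarrow> 'w \<Rightarrow> 'e) \<Rightarrow> bool" where
  "iid_with_law M E P X \<longleftrightarrow>
     prob_space.indep_vars M (\<lambda>_. E) X {1..} \<and> (\<forall>i\<ge>1. distr M E (X i) = P)"

end

theory Submission
  imports Defs
begin

text \<open>
  Convexity turns pointwise convergence of the empirical risks into consistency. Suppose that
  \<open>\<Phi>\<^sub>n \<rightarrow> \<Phi>\<close> holds at one minimizer \<open>x0\<close> of \<open>\<Phi>\<close> and on a suitable countable set \<open>D\<close>; by the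
  strong law of large numbers this happens almost surely. If the empirical minimizers stayed at
  distance at least \<open>e\<close> from the set \<open>K\<close> of minimizers along a subsequence, then each segment from
  \<open>x0\<close> to such a minimizer would cross the shell of points of \<open>\<Theta>\<close> at distance exactly \<open>e\<close> from
  \<open>K\<close>. By convexity \<open>\<Phi>\<^sub>n\<close> is at most \<open>\<Phi>\<^sub>n x0\<close> at the crossing point. The shell is compact
  when \<open>e\<close> is small, so the crossing points accumulate at some \<open>z\<close>, and in the limit
  \<open>\<Phi> z \<le> \<Phi> x0\<close>. Thus \<open>z\<close> minimizes \<open>\<Phi>\<close> although it lies off \<open>K\<close>, a contradiction
  (\<open>convex_argmin_infdist_tendsto\<close>). The limit along moving points is
  \<open>convex_limit_le_of_moving_points\<close>, where convexity supplies the local upper bounds that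
  control \<open>\<Phi>\<^sub>n\<close> between the points of \<open>D\<close>.

  The strong law is proved for iid integrable variables through the maximal partial sums
  \<open>L\<^sub>n = max {S\<^sub>0, \<dots>, S\<^sub>n}\<close>. They satisfy \<open>L\<^sub>n\<^sub>+\<^sub>1 = max 0 (Y\<^sub>0 + L'\<^sub>n)\<close>, where \<open>L'\<^sub>n\<close> is built from the
  shifted sequence and has the law of \<open>L\<^sub>n\<close>. Hence \<open>E (max (- L'\<^sub>n) Y\<^sub>0) = E L\<^sub>n\<^sub>+\<^sub>1 - E L\<^sub>n \<ge> 0\<close>. If the
  partial sums were almost surely unbounded above, the left side would tend to \<open>E Y\<^sub>0\<close>; so a negative
  mean forces, by the zero-one law, almost surely bounded partial sums
  (\<open>AE_bdd_above_partial_sums_of_negative_mean\<close>). Applied to \<open>Y - E Y - r\<close> and to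
  \<open>- Y + E Y - r\<close>, this confines the averages to within \<open>r\<close> of \<open>E Y\<close> in the limit.
\<close>

section \<open>Maximal partial sums\<close>

text \<open>The recursion peels off the first summand rather than the last: this is the form in which the
  shifted sequence appears, on which the moment argument for the strong law rests.\<close>

fun max_partial_sum :: "nat \<Rightarrow> (nat \<Rightarrow> real) \<Rightarrow> real" where
  "max_partial_sum 0 v = 0"
| "max_partial_sum (Suc n) v = max 0 (v 0 + max_partial_sum n (\<lambda>i. v (Suc i)))"

lemma max_partial_sum_nonneg: "0 \<le> max_partial_sum n v"
  by (cases n) auto

lemma partial_sum_le_max_partial_sum:
  "k \<le> n \<Longrightarrow> (\<Sum>i<k. v i) \<le> max_partial_sum n v"
proof (induction n arbitrary: k v)
  case (Suc n)
  show ?case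
  proof (cases k)
    case (Suc l)
    then show ?thesis
      using Suc.IH[of l "\<lambda>i. v (Suc i)"] Suc.prems by (simp add: sum.lessThan_Suc_shift del: sum.lessThan_Suc)
  qed (simp add: max_partial_sum_nonneg)
qed simp

lemma max_partial_sum_Suc_mono: "max_partial_sum n v \<le> max_partial_sum (Suc n) v"
proof (induction n arbitrary: v)
  case (Suc n)
  then show ?case
    using Suc.IH[of "\<lambda>i. v (Suc i)"] by (auto simp: max_def)
qed simp

lemma measurable_max_partial_sum [measurable]:
  "max_partial_sum n \<in> borel_measurable (Pi\<^sub>M UNIV (\<lambda>_. borel))"
proof (induction n)
  case (Suc n)
  have shift: "(\<lambda>v i. v (Suc i)) \<in>
      measurable (Pi\<^sub>M UNIV (\<lambda>_. borel)) (Pi\<^sub>M UNIV (\<lambda>_. borel :: real measure))"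
    by (rule measurable_PiM_single') (auto simp: space_PiM)
  have "(\<lambda>v. max_partial_sum n (\<lambda>i. v (Suc i))) \<in> borel_measurable (Pi\<^sub>M UNIV (\<lambda>_. borel))"
    using measurable_compose[OF shift Suc.IH] by simp
  then show ?case
    by simp
qed simp

text \<open>Discarding a first summand moves every partial sum by the same constant, which is what makes
  boundedness of the partial sums a tail event.\<close>

lemma bdd_above_partial_sums_Suc_iff:
  fixes v :: "nat \<Rightarrow> real"
  shows "bdd_above (range (\<lambda>k. \<Sum>i<k. v (Suc i))) \<longleftrightarrow> bdd_above (range (\<lambda>k. \<Sum>i<k. v i))"
proof
  assume "bdd_above (range (\<lambda>k. \<Sum>i<k. v (Suc i)))"
  then obtain c where c: "(\<Sum>i<k. v (Suc i)) \<le> c" for k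
    by (auto simp: bdd_above_def)
  have "(\<Sum>i<k. v i) \<le> max 0 (v 0 + c)" for k
    using c[of "k - 1"] by (cases k) (auto simp: sum.lessThan_Suc_shift simp del: sum.lessThan_Suc)
  then show "bdd_above (range (\<lambda>k. \<Sum>i<k. v i))"
    by (auto simp: bdd_above_def)
next
  assume "bdd_above (range (\<lambda>k. \<Sum>i<k. v i))"
  then obtain c where c: "(\<Sum>i<k. v i) \<le> c" for k
    by (auto simp: bdd_above_def)
  have "(\<Sum>i<k. v (Suc i)) \<le> c - v 0" for k
    using c[of "Suc k"] by (auto simp: sum.lessThan_Suc_shift simp del: sum.lessThan_Suc)
  then show "bdd_above (range (\<lambda>k. \<Sum>i<k. v (Suc i)))"
    by (auto simp: bdd_above_def)
qed

lemma bdd_above_partial_sums_shift_iff: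
  fixes v :: "nat \<Rightarrow> real"
  shows "bdd_above (range (\<lambda>k. \<Sum>i<k. v (n + i))) \<longleftrightarrow> bdd_above (range (\<lambda>k. \<Sum>i<k. v i))"
proof (induction n)
  case (Suc n)
  then show ?case
    using bdd_above_partial_sums_Suc_iff[of "\<lambda>i. v (n + i)"] by simp
qed simp

text \<open>Quantifying over natural numbers only makes the event of unbounded partial sums measurable.\<close>

lemma not_bdd_above_real_iff:
  fixes f :: "nat \<Rightarrow> real"
  shows "\<not> bdd_above (range f) \<longleftrightarrow> (\<forall>c::nat. \<exists>k. real c < f k)"
proof
  assume "\<forall>c::nat. \<exists>k. real c < f k"
  then show "\<not> bdd_above (range f)"
    by (meson bdd_above.E linorder_not_le order_trans rangeI real_arch_simple)
qed (auto simp: bdd_above_def not_le)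

section \<open>The strong law of large numbers\<close>

context prob_space
begin

lemma unbounded_partial_sums_zero_one:
  fixes Y :: "nat \<Rightarrow> 'a \<Rightarrow> real"
  assumes indep: "indep_vars (\<lambda>_. borel) Y UNIV"
  defines "B \<equiv> {\<omega> \<in> space M. \<not> bdd_above (range (\<lambda>k. \<Sum>i<k. Y i \<omega>))}"
  shows "prob B = 0 \<or> prob B = 1"
proof -
  \<comment> \<open>The \<open>\<sigma>\<close>-algebra generated by \<open>Y i\<close>.\<close>
  define A where "A i = sigma_sets (space M) {Y i -` S \<inter> space M | S. S \<in> sets borel}" for i
  have rv: "random_variable borel (Y i)" for i
    using indep by (auto simp: indep_vars_def)
  have A: "A i \<subseteq> Pow (space M)" for i
    unfolding A_def using sigma_sets_into_sp[of "{Y i -` S \<inter> space M | S. S \<in> sets borel}" "space M"] by blast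
  have "B \<in> sigma_sets (space M) (\<Union> (A ` {n..}))" for n
  proof -
    define T where "T = sigma (space M) (\<Union> (A ` {n..}))"
    have spT: "space T = space M" and setsT: "sets T = sigma_sets (space M) (\<Union> (A ` {n..}))"
      using A unfolding T_def by (auto intro!: space_measure_of sets_measure_of)
    have [measurable]: "Y (n + i) \<in> borel_measurable T" for i
    proof (rule measurableI)
      fix S :: "real set" assume "S \<in> sets borel"
      then have "Y (n + i) -` S \<inter> space M \<in> A (n + i)"
        unfolding A_def by auto
      then show "Y (n + i) -` S \<inter> space T \<in> sets T"
        unfolding spT setsT by (intro sigma_sets.Basic) auto
    qed simp
    \<comment> \<open>Only the variables from index \<open>n\<close> on matter for \<open>B\<close>, so it is measurable with respect to them.\<close>
    have "B = {\<omega> \<in> space T. \<forall>c::nat. \<exists>k. real c < (\<Sum>i<k. Y (n + i) \<omega>)}"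
      unfolding B_def spT not_bdd_above_real_iff[symmetric]
      by (simp add: bdd_above_partial_sums_shift_iff[of "\<lambda>i. Y i _" n])
    also have "\<dots> \<in> sets T"
      by measurable
    finally show ?thesis
      by (simp add: setsT)
  qed
  then have "B \<in> tail_events A"
    by (simp add: tail_events_def)
  moreover have "indep_sets A UNIV"
    using indep by (simp add: indep_vars_def A_def[abs_def])
  moreover have "sigma_algebra (space M) (A i)" for i
    unfolding A_def by (rule sigma_algebra_sigma_sets) auto
  ultimately show ?thesis
    by (intro kolmogorov_0_1_law)
qed

text \<open>Both path laws are the infinite product of the common marginal law, and re-indexing along the
  injection \<open>Suc\<close> preserves an infinite product of equal factors.\<close>

lemma distr_iid_shift:
  assumes indep: "indep_vars (\<lambda>_. N) Y (UNIV :: nat set)"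
    and ident: "\<And>i. distr M N (Y i) = distr M N (Y 0)"
  shows "distr M (Pi\<^sub>M UNIV (\<lambda>_. N)) (\<lambda>\<omega> i. Y (Suc i) \<omega>) =
         distr M (Pi\<^sub>M UNIV (\<lambda>_. N)) (\<lambda>\<omega> i. Y i \<omega>)"
proof -
  let ?D = "distr M N (Y 0)" and ?S = "Pi\<^sub>M (UNIV :: nat set) (\<lambda>_. N)"
  have rv: "random_variable N (Y i)" for i
    using indep by (auto simp: indep_vars_def)
  have law: "distr M ?S (\<lambda>\<omega> i. Y i \<omega>) = Pi\<^sub>M UNIV (\<lambda>_. ?D)"
    using indep_vars_iff_distr_eq_PiM[where I = UNIV and M' = "\<lambda>_. N" and X = Y] indep rv
    by (simp add: ext[where f = "\<lambda>i. distr M N (Y i)", OF ident] restrict_def)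
  interpret D: prob_space ?D
    by (rule prob_space_distr) (rule rv)
  have path [measurable]: "(\<lambda>\<omega> i. Y i \<omega>) \<in> measurable M ?S"
    by (rule measurable_PiM_single') (auto simp: space_PiM intro: rv measurable_space[OF rv])
  have shift: "(\<lambda>v i. v (Suc i)) \<in> measurable ?S ?S"
    by (rule measurable_PiM_single') (auto simp: space_PiM)
  have sets: "sets (Pi\<^sub>M UNIV (\<lambda>_::nat. ?D)) = sets ?S"
    by (intro sets_PiM_cong) auto
  have "distr M ?S (\<lambda>\<omega> i. Y (Suc i) \<omega>) = distr (distr M ?S (\<lambda>\<omega> i. Y i \<omega>)) ?S (\<lambda>v i. v (Suc i))"
    using distr_distr[OF shift path] by (simp add: comp_def)
  also have "\<dots> = distr (Pi\<^sub>M UNIV (\<lambda>_. ?D)) (Pi\<^sub>M UNIV (\<lambda>_. ?D)) (\<lambda>v i. v (Suc i))"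
    unfolding law by (rule distr_cong) (auto simp: sets)
  also have "\<dots> = Pi\<^sub>M UNIV (\<lambda>_. ?D)"
    using distr_PiM_reindex[of UNIV "\<lambda>_. ?D" Suc UNIV] D.prob_space_axioms by (simp add: restrict_def)
  finally show ?thesis
    by (simp add: law)
qed

text \<open>The expectations of \<open>max (- L' n) (Y 0)\<close> are nonnegative, by the recursion for the maximal
  partial sums and stationarity. On unbounded paths this integrand is eventually equal to \<open>Y 0\<close>, so
  almost sure unboundedness would force a nonnegative mean; the zero-one law leaves boundedness as
  the only alternative.\<close>

lemma AE_bdd_above_partial_sums_of_negative_mean:
  fixes Y :: "nat \<Rightarrow> 'a \<Rightarrow> real"
  assumes indep: "indep_vars (\<lambda>_. borel) Y UNIV"
    and ident: "\<And>i. distr M borel (Y i) = distr M borel (Y 0)"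
    and int: "integrable M (Y 0)"
    and neg: "expectation (Y 0) < 0"
  shows "AE \<omega> in M. bdd_above (range (\<lambda>k. \<Sum>i<k. Y i \<omega>))"
proof -
  let ?S = "Pi\<^sub>M (UNIV :: nat set) (\<lambda>_. borel :: real measure)"
  define B where "B = {\<omega> \<in> space M. \<not> bdd_above (range (\<lambda>k. \<Sum>i<k. Y i \<omega>))}"
  have rv [measurable]: "random_variable borel (Y i)" for i
    using indep by (auto simp: indep_vars_def)
  have [measurable]: "B \<in> events"
    unfolding B_def not_bdd_above_real_iff by measurable
  have intY: "integrable M (Y i)" for i
  proof -
    have "integrable (distr M borel (Y i)) (\<lambda>x. x)"
      using int unfolding ident[of i] by (subst integrable_distr_eq) auto
    then show ?thesis
      by (subst (asm) integrable_distr_eq) auto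
  qed
  have intL: "integrable M (\<lambda>\<omega>. max_partial_sum n (\<lambda>i. Y (j + i) \<omega>))" for n j
  proof (induction n arbitrary: j)
    case (Suc n)
    have "integrable M (\<lambda>\<omega>. max_partial_sum n (\<lambda>i. Y (j + Suc i) \<omega>))"
      using Suc.IH[of "Suc j"] by simp
    then show ?case
      by (auto intro!: integrable_max intY)
  qed simp
  define L where "L n \<omega> = max_partial_sum n (\<lambda>i. Y i \<omega>)" for n \<omega>
  define L' where "L' n \<omega> = max_partial_sum n (\<lambda>i. Y (Suc i) \<omega>)" for n \<omega>
  have intL0: "integrable M (L n)" and intL1: "integrable M (L' n)" for n
    using intL[of n 0] intL[of n 1] by (simp_all add: L_def[abs_def] L'_def[abs_def])
  have same: "expectation (L' n) = expectation (L n)" for n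
  proof -
    have "expectation (L' n) = integral\<^sup>L (distr M ?S (\<lambda>\<omega> i. Y (Suc i) \<omega>)) (max_partial_sum n)"
      unfolding L'_def by (subst integral_distr) (auto intro!: measurable_PiM_single' simp: space_PiM)
    also have "\<dots> = integral\<^sup>L (distr M ?S (\<lambda>\<omega> i. Y i \<omega>)) (max_partial_sum n)"
      by (subst distr_iid_shift[OF indep ident]) rule
    also have "\<dots> = expectation (L n)"
      unfolding L_def by (subst integral_distr) (auto intro!: measurable_PiM_single' simp: space_PiM)
    finally show ?thesis .
  qed
  have step: "0 \<le> expectation (\<lambda>\<omega>. max (- L' n \<omega>) (Y 0 \<omega>))" for n
  proof -
    have "max (- L' n \<omega>) (Y 0 \<omega>) = L (Suc n) \<omega> - L' n \<omega>" for \<omega>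
      \<comment> \<open>Subtract \<open>L' n\<close> inside the maximum of the recursion.\<close>
      by (simp add: L_def L'_def)
    then have "expectation (\<lambda>\<omega>. max (- L' n \<omega>) (Y 0 \<omega>)) = expectation (L (Suc n)) - expectation (L n)"
      using intL0 intL1 by (simp add: same)
    moreover have "expectation (L n) \<le> expectation (L (Suc n))"
      using intL0 by (rule integral_mono) (simp_all only: L_def intL0 max_partial_sum_Suc_mono)
    ultimately show ?thesis
      by simp
  qed
  have "prob B \<noteq> 1"
  proof
    assume "prob B = 1"
    then have AEB: "AE \<omega> in M. \<omega> \<in> B"
      by (simp add: prob_eq_1)
    have "(\<lambda>n. expectation (\<lambda>\<omega>. max (- L' n \<omega>) (Y 0 \<omega>))) \<longlonglongrightarrow> expectation (Y 0)"
    proof (rule integral_dominated_convergence[where w = "\<lambda>\<omega>. \<bar>Y 0 \<omega>\<bar>"])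
      show "AE \<omega> in M. (\<lambda>n. max (- L' n \<omega>) (Y 0 \<omega>)) \<longlonglongrightarrow> Y 0 \<omega>"
        using AEB
      proof eventually_elim
        case (elim \<omega>)
        then have "\<not> bdd_above (range (\<lambda>k. \<Sum>i<k. Y (Suc i) \<omega>))"
          using bdd_above_partial_sums_Suc_iff[of "\<lambda>i. Y i \<omega>"] by (simp add: B_def)
        then obtain k where k: "- Y 0 \<omega> < (\<Sum>i<k. Y (Suc i) \<omega>)"
          by (auto simp: bdd_above_def not_le)
        have "max (- L' n \<omega>) (Y 0 \<omega>) = Y 0 \<omega>" if "n \<ge> k" for n
          using k partial_sum_le_max_partial_sum[OF that, of "\<lambda>i. Y (Suc i) \<omega>"]
          by (simp add: L'_def)
        then show ?case
          by (intro tendsto_eventually eventually_sequentiallyI[of k])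
      qed
      show "AE \<omega> in M. norm (max (- L' n \<omega>) (Y 0 \<omega>)) \<le> \<bar>Y 0 \<omega>\<bar>" for n
        using max_partial_sum_nonneg[of n] by (auto simp: L'_def max_def)
      show "(\<lambda>\<omega>. max (- L' n \<omega>) (Y 0 \<omega>)) \<in> borel_measurable M" for n
        using intL1 by (auto intro!: borel_measurable_max)
    qed (use int in auto)
    then have "0 \<le> expectation (Y 0)"
      by (rule LIMSEQ_le_const) (use step in blast)
    with neg show False
      by simp
  qed
  then have "prob B = 0"
    using unbounded_partial_sums_zero_one[OF indep] by (auto simp: B_def)
  then have "AE \<omega> in M. \<omega> \<notin> B"
    by (simp add: prob_eq_0)
  then show ?thesis
    by (rule AE_mp) (auto simp: B_def)
qed

text \<open>Centring at \<open>a = E Y + r / 2\<close> makes the mean negative, so \<open>S\<^sub>n \<le> n a + c\<close> for a constant \<open>c\<close>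
  depending on the path; the other half of \<open>r\<close> absorbs \<open>c / n\<close>.\<close>

lemma AE_averages_eventually_le:
  fixes Y :: "nat \<Rightarrow> 'a \<Rightarrow> real"
  assumes indep: "indep_vars (\<lambda>_. borel) Y UNIV"
    and ident: "\<And>i. distr M borel (Y i) = distr M borel (Y 0)"
    and int: "integrable M (Y 0)"
    and r: "r > 0"
  shows "AE \<omega> in M. \<forall>\<^sub>F n in sequentially. (\<Sum>i<n. Y i \<omega>) / real n \<le> expectation (Y 0) + r"
proof -
  define a where "a = expectation (Y 0) + r / 2"
  have rv [measurable]: "random_variable borel (Y i)" for i
    using indep by (auto simp: indep_vars_def)
  have "AE \<omega> in M. bdd_above (range (\<lambda>k. \<Sum>i<k. Y i \<omega> - a))"
  proof (rule AE_bdd_above_partial_sums_of_negative_mean)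
    show "indep_vars (\<lambda>_. borel) (\<lambda>i \<omega>. Y i \<omega> - a) UNIV"
      by (rule indep_vars_compose2[OF indep]) auto
    have "distr M borel (\<lambda>\<omega>. Y i \<omega> - a) = distr (distr M borel (Y i)) borel (\<lambda>x. x - a)" for i
      by (subst distr_distr) (auto simp: comp_def)
    then show "distr M borel (\<lambda>\<omega>. Y i \<omega> - a) = distr M borel (\<lambda>\<omega>. Y 0 \<omega> - a)" for i
      by (simp add: ident[of i])
    show "expectation (\<lambda>\<omega>. Y 0 \<omega> - a) < 0"
      using int r by (simp add: a_def prob_space)
  qed (use int in auto)
  then show ?thesis
  proof eventually_elim
    case (elim \<omega>)
    then obtain c where c: "(\<Sum>i<k. Y i \<omega> - a) \<le> c" for k
      by (auto simp: bdd_above_def)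
    obtain m :: nat where m: "c / (r / 2) \<le> real m"
      using real_arch_simple by blast
    have "(\<Sum>i<n. Y i \<omega>) / real n \<le> expectation (Y 0) + r" if "n \<ge> Suc m" for n
    proof -
      have n: "real n > 0" "real m \<le> real n"
        using that by auto
      have "c \<le> real m * (r / 2)"
        using m r by (simp add: field_simps)
      also have "\<dots> \<le> real n * (r / 2)"
        using n r by (intro mult_right_mono) auto
      finally have "(\<Sum>i<n. Y i \<omega>) \<le> real n * a + real n * (r / 2)"
        using c[of n] by (simp add: sum_subtractf)
      then show ?thesis
        using n by (simp add: a_def field_simps)
    qed
    then show ?case
      by (rule eventually_sequentiallyI)
  qed
qed

text \<open>The upper bounds for \<open>Y\<close> and for \<open>- Y\<close>, taken along the countably many margins
  \<open>1 / (m + 1)\<close>, hold simultaneously almost surely.\<close>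

theorem strong_law_of_large_numbers:
  fixes Y :: "nat \<Rightarrow> 'a \<Rightarrow> real"
  assumes indep: "indep_vars (\<lambda>_. borel) Y UNIV"
    and ident: "\<And>i. distr M borel (Y i) = distr M borel (Y 0)"
    and int: "integrable M (Y 0)"
  shows "AE \<omega> in M. (\<lambda>n. (\<Sum>i<n. Y i \<omega>) / real n) \<longlonglongrightarrow> expectation (Y 0)"
proof -
  have rv [measurable]: "random_variable borel (Y i)" for i
    using indep by (auto simp: indep_vars_def)
  have upper: "AE \<omega> in M. \<forall>m::nat. \<forall>\<^sub>F n in sequentially.
      (\<Sum>i<n. Y i \<omega>) / real n \<le> expectation (Y 0) + inverse (real (Suc m))"
    unfolding AE_all_countable
    by (intro allI AE_averages_eventually_le indep ident int) auto
  have "distr M borel (\<lambda>\<omega>. - Y i \<omega>) = distr (distr M borel (Y i)) borel uminus" for i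
    by (subst distr_distr) (auto simp: comp_def)
  then have ident': "distr M borel (\<lambda>\<omega>. - Y i \<omega>) = distr M borel (\<lambda>\<omega>. - Y 0 \<omega>)" for i
    by (simp add: ident[of i])
  have "AE \<omega> in M. \<forall>m::nat. \<forall>\<^sub>F n in sequentially.
      (\<Sum>i<n. - Y i \<omega>) / real n \<le> expectation (\<lambda>\<omega>. - Y 0 \<omega>) + inverse (real (Suc m))"
    unfolding AE_all_countable
    by (intro allI AE_averages_eventually_le ident' indep_vars_compose2[OF indep]) (use int in auto)
  with upper show ?thesis
  proof eventually_elim
    case (elim \<omega>)
    show ?case
    proof (rule tendstoI)
      fix e :: real assume "e > 0"
      then obtain m where m: "inverse (real (Suc m)) < e"
        using reals_Archimedean by blast
      from elim(1)[rule_format, of m] elim(2)[rule_format, of m]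
      show "\<forall>\<^sub>F n in sequentially. dist ((\<Sum>i<n. Y i \<omega>) / real n) (expectation (Y 0)) < e"
        by eventually_elim (use m in \<open>auto simp: dist_real_def sum_negf\<close>)
    qed
  qed
qed

end


section \<open>Limits of convex functions known on a countable set\<close>

text \<open>A small cube around \<open>z\<close> is the convex hull of its finitely many vertices.\<close>

lemma finite_hull_neighbourhood:
  fixes U :: "'a::euclidean_space set"
  assumes "open U" "z \<in> U"
  obtains S where "finite S" "S \<subseteq> U" "z \<in> interior (convex hull S)"
proof -
  obtain e where e: "e > 0" "cball z e \<subseteq> U"
    using assms open_contains_cball by blast
  \<comment> \<open>The cube of half-width \<open>d\<close> fits in the ball because the norm is at most the sum of the
      absolute coordinates.\<close>
  define d where "d = e / real DIM('a)"
  have d: "d > 0" "real DIM('a) * d = e"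
    using e by (auto simp: d_def)
  let ?v = "\<Sum>i\<in>Basis. d *\<^sub>R i :: 'a"
  obtain S where S: "finite S" "cbox (z - ?v) (z + ?v) = convex hull S"
    using cube_convex_hull[OF d(1)] by blast
  have v: "?v \<bullet> i = d" if "i \<in> Basis" for i
    using that by (simp add: inner_sum_left inner_Basis if_distrib sum.delta cong: if_cong)
  have "cbox (z - ?v) (z + ?v) \<subseteq> cball z e"
  proof
    fix x assume "x \<in> cbox (z - ?v) (z + ?v)"
    then have "\<bar>(z - x) \<bullet> i\<bar> \<le> d" if "i \<in> Basis" for i
      using that v[OF that] by (auto simp: mem_box algebra_simps inner_diff_left inner_add_left abs_le_iff)
    then have "(\<Sum>i\<in>Basis. \<bar>(z - x) \<bullet> i\<bar>) \<le> (\<Sum>i\<in>(Basis::'a set). d)"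
      by (intro sum_mono)
    then have "norm (z - x) \<le> e"
      using norm_le_l1[of "z - x"] d(2) by simp
    then show "x \<in> cball z e"
      by (simp add: dist_norm)
  qed
  moreover have "z \<in> interior (cbox (z - ?v) (z + ?v))"
    using d v by (simp add: interior_cbox mem_box inner_diff_left inner_add_left)
  ultimately show thesis
    using that[of S] S e(2) hull_subset[of S convex] by (metis subset_trans)
qed

text \<open>Density gives access to values near a point. The finite sets whose hulls surround a point give
  upper bounds there for convex functions. By Lindeloef's theorem countably many of these sets suffice.\<close>

lemma countable_locally_spanning_dense_subset:
  fixes U :: "'a::euclidean_space set"
  assumes "open U"
  obtains D where "countable D" "D \<subseteq> U"
    "\<And>V. open V \<Longrightarrow> V \<inter> U \<noteq> {} \<Longrightarrow> V \<inter> D \<noteq> {}"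
    "\<And>z. z \<in> U \<Longrightarrow> \<exists>S\<subseteq>D. finite S \<and> z \<in> interior (convex hull S)"
proof -
  obtain D0 :: "'a set" where D0: "countable D0" "\<And>V. open V \<Longrightarrow> V \<noteq> {} \<Longrightarrow> \<exists>d\<in>D0. d \<in> V"
    using countable_dense_setE by blast
  define \<S> where "\<S> = {S. finite S \<and> S \<subseteq> U}"
  obtain \<F> where \<F>: "\<F> \<subseteq> (\<lambda>S. interior (convex hull S)) ` \<S>" "countable \<F>"
      "\<Union>\<F> = \<Union>((\<lambda>S. interior (convex hull S)) ` \<S>)"
    using Lindelof[of "(\<lambda>S. interior (convex hull S)) ` \<S>"] by blast
  obtain \<S>' where \<S>': "\<S>' \<subseteq> \<S>" "countable \<S>'" "\<F> = (\<lambda>S. interior (convex hull S)) ` \<S>'"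
    using \<F>(1,2) by (meson countable_subset_image)
  show thesis
  proof (rule that[of "(D0 \<inter> U) \<union> \<Union>\<S>'"])
    show "countable (D0 \<inter> U \<union> \<Union>\<S>')"
      proof -
      have "countable (\<Union>S\<in>\<S>'. S)"
        using \<S>'(1) by (intro countable_UN[OF \<S>'(2)] countable_finite) (auto simp: \<S>_def)
      with D0(1) show ?thesis
        by (simp add: countable_Int1)
    qed
    show "D0 \<inter> U \<union> \<Union>\<S>' \<subseteq> U"
      using \<S>'(1) by (auto simp: \<S>_def)
    show "V \<inter> (D0 \<inter> U \<union> \<Union>\<S>') \<noteq> {}" if "open V" "V \<inter> U \<noteq> {}" for V
      using D0(2)[of "V \<inter> U"] that assms by (auto simp: open_Int)
    show "\<exists>S\<subseteq>D0 \<inter> U \<union> \<Union>\<S>'. finite S \<and> z \<in> interior (convex hull S)" if "z \<in> U" for z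
    proof -
      obtain S where "finite S" "S \<subseteq> U" "z \<in> interior (convex hull S)"
        using finite_hull_neighbourhood[OF assms \<open>z \<in> U\<close>] .
      then have "S \<in> \<S>" "z \<in> interior (convex hull S)"
        by (simp_all add: \<S>_def)
      then have "z \<in> \<Union>\<F>"
        unfolding \<F>(3) by blast
      then obtain S' where S': "S' \<in> \<S>'" "z \<in> interior (convex hull S')"
        unfolding \<S>'(3) by blast
      then have "finite S'"
        using \<S>'(1) by (auto simp: \<S>_def)
      with S' show ?thesis
        by (intro exI[of _ S']) auto
    qed
  qed
qed

text \<open>Convergence is known only on \<open>D\<close>, whereas the points \<open>x n\<close> move. On a ball around \<open>z\<close> the
  functions are eventually bounded by a constant \<open>C\<close>, by their values at finitely many points of \<open>D\<close>.
  A point \<open>w\<close> of \<open>D\<close> very close to \<open>z\<close> is a convex combination \<open>(1 - t) x n + t u n\<close> with \<open>u n\<close> in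
  that ball, so \<open>g w \<le> (1 - t) b + t C\<close> in the limit. Letting \<open>w\<close> tend to \<open>z\<close> and then \<open>t\<close> to \<open>0\<close>
  gives the claim.\<close>

lemma convex_limit_le_of_moving_points:
  fixes f :: "nat \<Rightarrow> 'a::euclidean_space \<Rightarrow> real"
  assumes U: "open U"
    and f: "\<And>n. convex_on U (f n)" and g: "convex_on U g"
    and D: "D \<subseteq> U"
    and dense: "\<And>V. open V \<Longrightarrow> V \<inter> U \<noteq> {} \<Longrightarrow> V \<inter> D \<noteq> {}"
    and hull: "\<And>z. z \<in> U \<Longrightarrow> \<exists>S\<subseteq>D. finite S \<and> z \<in> interior (convex hull S)"
    and lim: "\<And>w. w \<in> D \<Longrightarrow> (\<lambda>n. f n w) \<longlonglongrightarrow> g w"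
    and x: "\<And>n. x n \<in> U" "x \<longlonglongrightarrow> z" "z \<in> U"
    and c: "\<And>n. f n (x n) \<le> c n" "c \<longlonglongrightarrow> b"
  shows "g z \<le> b"
proof -
  have "convex U"
    using g by (rule convex_on_imp_convex)
  obtain S where S: "S \<subseteq> D" "finite S" "z \<in> interior (convex hull S)"
    using hull[OF x(3)] by blast
  have SU: "convex hull S \<subseteq> U"
    using S D \<open>convex U\<close> by (simp add: hull_minimal)
  obtain d where d: "d > 0" "ball z d \<subseteq> convex hull S"
    using S(3) by (auto simp: mem_interior)
  \<comment> \<open>Inserting \<open>0\<close> avoids the maximum of an empty set; adding \<open>1\<close> leaves room for convergence.\<close>
  define C where "C = Max (insert 0 (g ` S)) + 1"
  have "\<forall>\<^sub>F n in sequentially. \<forall>s\<in>S. f n s < C"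
  proof (rule eventually_ball_finite[OF S(2)], intro ballI)
    fix s assume s: "s \<in> S"
    then have "g s \<le> Max (insert 0 (g ` S))"
      using S(2) by (intro Max_ge) auto
    then have "g s < C"
      by (simp add: C_def)
    then show "\<forall>\<^sub>F n in sequentially. f n s < C"
      using lim s S(1) by (intro order_tendstoD(2)[of _ "g s"]) auto
  qed
  then have bound: "\<forall>\<^sub>F n in sequentially. \<forall>y\<in>ball z d. f n y \<le> C"
  proof eventually_elim
    case (elim n)
    have "convex_on (convex hull S) (f n)"
      using f SU by (rule convex_on_subset) simp
    then have "\<forall>y\<in>convex hull S. f n y \<le> C"
      using elim by (intro convex_on_convex_hull_bound) auto
    then show ?case
      using d by blast
  qed
  have near: "g w \<le> (1 - t) * b + t * C" if t: "0 < t" "t < 1" and w: "w \<in> D" "dist z w < t * d" for t w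
  proof -
    \<comment> \<open>The point beyond \<open>w\<close> on the ray from \<open>x n\<close> for which \<open>w\<close> lies at parameter \<open>t\<close>.\<close>
    define u where "u n = x n + (1 / t) *\<^sub>R (w - x n)" for n
    have "u \<longlonglongrightarrow> z + (1 / t) *\<^sub>R (w - z)"
      unfolding u_def by (intro tendsto_intros x)
    moreover have "z + (1 / t) *\<^sub>R (w - z) \<in> ball z d"
      using t w by (simp add: dist_norm norm_minus_commute pos_divide_less_eq mult.commute)
    ultimately have "\<forall>\<^sub>F n in sequentially. u n \<in> ball z d"
      using topological_tendstoD by (metis open_ball)
    with bound have "\<forall>\<^sub>F n in sequentially. f n w \<le> (1 - t) * c n + t * C"
    proof eventually_elim
      case (elim n)
      then have uU: "u n \<in> U" and fu: "f n (u n) \<le> C"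
        using d SU by auto
      have "w = (1 - t) *\<^sub>R x n + t *\<^sub>R u n"
        using t by (simp add: u_def algebra_simps)
      then have "f n w \<le> (1 - t) * f n (x n) + t * f n (u n)"
        using convex_onD[OF f, of t "x n" "u n"] t x(1) uU by simp
      also have "\<dots> \<le> (1 - t) * c n + t * C"
        using t c(1) fu by (intro add_mono mult_left_mono) auto
      finally show ?case .
    qed
    moreover have "(\<lambda>n. (1 - t) * c n + t * C) \<longlonglongrightarrow> (1 - t) * b + t * C"
      by (intro tendsto_intros c)
    ultimately show ?thesis
      using lim[OF w(1)] by (intro tendsto_le) auto
  qed
  have cont: "isCont g z"
    using convex_on_continuous[OF U g] U x(3) by (simp add: continuous_on_eq_continuous_at)
  have at_z: "g z \<le> (1 - t) * b + t * C" if t: "0 < t" "t < 1" for t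
  proof (rule ccontr)
    assume "\<not> ?thesis"
    then have "\<forall>\<^sub>F y in nhds z. (1 - t) * b + t * C < g y"
      using cont by (intro order_tendstoD(1)[of g "g z"]) (auto simp: isCont_def tendsto_at_iff_tendsto_nhds)
    then obtain V where V: "open V" "z \<in> V" "\<And>y. y \<in> V \<Longrightarrow> (1 - t) * b + t * C < g y"
      by (auto simp: eventually_nhds)
    have "z \<in> V \<inter> ball z (t * d) \<inter> U"
      using V t d x(3) by simp
    then have "V \<inter> ball z (t * d) \<inter> D \<noteq> {}"
      using V(1) by (intro dense) auto
    then obtain w where "w \<in> V" "w \<in> ball z (t * d)" "w \<in> D"
      by blast
    then show False
      using near[OF t, of w] V(3)[of w] by simp
  qed
  have "((\<lambda>t. (1 - t) * b + t * C) \<longlongrightarrow> (1 - 0) * b + 0 * C) (at_right 0)"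
    by (intro tendsto_intros)
  moreover have "\<forall>\<^sub>F t in at_right (0::real). g z \<le> (1 - t) * b + t * C"
    using at_z by (auto simp: eventually_at_right_field intro!: exI[of _ 1])
  ultimately show ?thesis
    using tendsto_lowerbound[of _ "(1 - 0) * b + 0 * C" "at_right (0::real)" "g z"] by simp
qed

section \<open>Consistency of minimizers of convex functions\<close>

lemma mem_argmin_on_iff:
  "x \<in> argmin_on f T \<longleftrightarrow> x \<in> T \<and> (\<forall>y\<in>T. f x \<le> f y)"
  by (auto simp: argmin_on_def is_arg_min_def not_less)

text \<open>The point \<open>x0\<close> anchors the comparison: convexity along the segment from \<open>x0\<close> to a distant
  minimizer of \<open>f n\<close> keeps \<open>f n\<close> below \<open>f n x0\<close>, also where the segment crosses a compact shell
  around the minimizers of \<open>g\<close>. A limit of such crossing points would minimize \<open>g\<close>.\<close>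

lemma convex_argmin_infdist_tendsto:
  fixes f :: "nat \<Rightarrow> 'a::euclidean_space \<Rightarrow> real"
  assumes U: "open U"
    and T: "closedin (top_of_set U) T" "convex T"
    and f: "\<And>n. convex_on U (f n)" and g: "convex_on U g"
    and D: "D \<subseteq> U"
    and dense: "\<And>V. open V \<Longrightarrow> V \<inter> U \<noteq> {} \<Longrightarrow> V \<inter> D \<noteq> {}"
    and hull: "\<And>z. z \<in> U \<Longrightarrow> \<exists>S\<subseteq>D. finite S \<and> z \<in> interior (convex hull S)"
    and lim: "\<And>w. w \<in> D \<Longrightarrow> (\<lambda>n. f n w) \<longlonglongrightarrow> g w"
    and K: "compact (argmin_on g T)"
    and x0: "x0 \<in> argmin_on g T" "(\<lambda>n. f n x0) \<longlonglongrightarrow> g x0"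
    and \<theta>: "\<forall>\<^sub>F n in sequentially. \<theta> n \<in> argmin_on (f n) T"
  shows "(\<lambda>n. infdist (\<theta> n) (argmin_on g T)) \<longlonglongrightarrow> 0"
proof (rule tendstoI)
  let ?K = "argmin_on g T"
  fix e0 :: real assume "e0 > 0"
  have "T \<subseteq> U"
    using T(1) by (simp add: closedin_def)
  then have KU: "?K \<subseteq> U"
    by (auto simp: mem_argmin_on_iff)
  obtain e1 where e1: "e1 > 0" "{x. infdist x ?K \<le> e1} \<subseteq> U"
    using compact_in_open_separated[OF _ K U KU] x0(1) by blast
  \<comment> \<open>\<open>T\<close> is closed only relative to \<open>U\<close>; the shell \<open>B\<close> is compact because its radius keeps
      it inside a compact subset of \<open>U\<close>.\<close>
  define e where "e = min e0 e1"
  have e: "e > 0" "{x. infdist x ?K \<le> e} \<subseteq> U"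
    using e1 \<open>e0 > 0\<close> by (auto simp: e_def)
  define B where "B = {x \<in> T. infdist x ?K = e}"
  obtain C where C: "closed C" "T = U \<inter> C"
    using T(1) by (auto simp: closedin_closed)
  have "B = {x. infdist x ?K \<le> e} \<inter> (C \<inter> {x. infdist x ?K = e})"
    using e(2) by (auto simp: B_def C)
  moreover have "compact {x. infdist x ?K \<le> e}"
    using x0(1) K e(1) by (intro compact_infdist_le) auto
  moreover have "closed (C \<inter> {x. infdist x ?K = e})"
    using C(1) by (intro closed_Int closed_Collect_eq continuous_intros)
  ultimately have B: "compact B"
    by (simp add: compact_Int_closed)
  have "\<forall>\<^sub>F n in sequentially. infdist (\<theta> n) ?K < e"
  proof (rule ccontr)
    assume "\<not> ?thesis"
    then have "\<exists>\<^sub>F n in sequentially. e \<le> infdist (\<theta> n) ?K"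
      by (simp add: not_eventually not_less)
    then have "\<exists>\<^sub>F n in sequentially. e \<le> infdist (\<theta> n) ?K \<and> \<theta> n \<in> argmin_on (f n) T"
      using \<theta> by (rule frequently_eventually_frequently)
    then have "infinite {n. e \<le> infdist (\<theta> n) ?K \<and> \<theta> n \<in> argmin_on (f n) T}"
      by (simp add: frequently_cofinite flip: cofinite_eq_sequentially)
    from infinite_enumerate[OF this] obtain r :: "nat \<Rightarrow> nat" where r: "strict_mono r"
        "\<And>n. e \<le> infdist (\<theta> (r n)) ?K" "\<And>n. \<theta> (r n) \<in> argmin_on (f (r n)) T"
      by auto
    have "\<exists>z\<in>B. f (r n) z \<le> f (r n) x0" for n
    proof -
      let ?p = "\<lambda>t. (1 - t) *\<^sub>R x0 + t *\<^sub>R \<theta> (r n)"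
      have T0: "x0 \<in> T" "\<theta> (r n) \<in> T" "f (r n) (\<theta> (r n)) \<le> f (r n) x0"
        using x0(1) r(3)[of n] by (auto simp: mem_argmin_on_iff)
      \<comment> \<open>The distance is \<open>0\<close> at \<open>x0\<close> and at least \<open>e\<close> at the other end of the segment.\<close>
      have "\<exists>t\<ge>0. t \<le> 1 \<and> infdist (?p t) ?K = e"
        using e(1) x0(1) r(2)[of n] by (intro IVT') (auto intro!: continuous_intros)
      then obtain t where t: "0 \<le> t" "t \<le> 1" "infdist (?p t) ?K = e"
        by blast
      then have "?p t \<in> B"
        using T(2) T0 by (auto simp: B_def intro: convexD)
      moreover have "f (r n) (?p t) \<le> (1 - t) * f (r n) x0 + t * f (r n) (\<theta> (r n))"
        using T0 \<open>T \<subseteq> U\<close> t by (intro convex_onD[OF f]) auto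
      moreover have "\<dots> \<le> (1 - t) * f (r n) x0 + t * f (r n) x0"
        using T0 t by (intro add_mono mult_left_mono) auto
      ultimately show ?thesis
        by (intro bexI[of _ "?p t"]) (auto simp: algebra_simps)
    qed
    then obtain y where y: "\<And>n. y n \<in> B" "\<And>n. f (r n) (y n) \<le> f (r n) x0"
      by metis
    obtain z s where z: "z \<in> B" "strict_mono s" "(y \<circ> s) \<longlonglongrightarrow> z"
      using B y(1) unfolding compact_def by metis
    have sub: "strict_mono (r \<circ> s)"
      using r(1) z(2) by (rule strict_mono_o)
    have "B \<subseteq> U"
      using \<open>T \<subseteq> U\<close> by (auto simp: B_def)
    have "g z \<le> g x0"
    proof (rule convex_limit_le_of_moving_points[OF U _ g D dense hull])
      show "convex_on U (f ((r \<circ> s) n))" for n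
        by (rule f)
      show "(\<lambda>n. f ((r \<circ> s) n) w) \<longlonglongrightarrow> g w" if "w \<in> D" for w
        using LIMSEQ_subseq_LIMSEQ[OF lim[OF that] sub] by (simp add: comp_def)
      show "(\<lambda>n. f ((r \<circ> s) n) x0) \<longlonglongrightarrow> g x0"
        using LIMSEQ_subseq_LIMSEQ[OF x0(2) sub] by (simp add: comp_def)
      show "f ((r \<circ> s) n) ((y \<circ> s) n) \<le> f ((r \<circ> s) n) x0" for n
        using y(2) by simp
    qed (use y z \<open>B \<subseteq> U\<close> in \<open>auto simp: comp_def\<close>)
    then have "z \<in> ?K"
      using z(1) x0(1) by (force simp: mem_argmin_on_iff B_def)
    then show False
      using z(1) e(1) by (simp add: B_def)
  qed
  then show "\<forall>\<^sub>F n in sequentially. dist (infdist (\<theta> n) ?K) 0 < e0"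
    by eventually_elim (simp add: e_def infdist_nonneg)
qed


section \<open>Empirical and population risks\<close>

lemma convex_on_empirical_risk:
  assumes "\<And>i. i \<ge> 1 \<Longrightarrow> X i \<omega> \<in> S" and "\<And>x. x \<in> S \<Longrightarrow> convex_on U (\<phi> x)" and "convex U"
  shows "convex_on U (empirical_risk X \<phi> n \<omega>)"
proof -
  have "convex_on U (\<lambda>\<theta>. \<Sum>i\<in>I. \<phi> (X i \<omega>) \<theta>)" if "finite I" "I \<subseteq> {1..}" for I
    using that by (induction I rule: finite_induct) (use assms in \<open>auto intro!: convex_on_add simp: convex_on_const\<close>)
  from convex_on_cmul[OF _ this[of "{1..n}"], of "1 / real n"] show ?thesis
    by (auto simp: empirical_risk_def[abs_def])
qed

lemma convex_on_population_risk:
  assumes X: "X 1 \<in> space M \<rightarrow> S"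
    and \<phi>: "\<And>x. x \<in> S \<Longrightarrow> convex_on U (\<phi> x)" and U: "convex U"
    and int: "\<And>\<theta>. \<theta> \<in> U \<Longrightarrow> integrable M (\<lambda>\<omega>. \<phi> (X 1 \<omega>) \<theta>)"
  shows "convex_on U (population_risk M X \<phi>)"
proof (rule convex_onI)
  fix t :: real and x y
  assume t: "0 < t" "t < 1" and xy: "x \<in> U" "y \<in> U"
  let ?z = "(1 - t) *\<^sub>R x + t *\<^sub>R y"
  have z: "?z \<in> U"
    using U t xy by (intro convexD) auto
  have "(\<integral>\<omega>. \<phi> (X 1 \<omega>) ?z \<partial>M) \<le> (\<integral>\<omega>. (1 - t) * \<phi> (X 1 \<omega>) x + t * \<phi> (X 1 \<omega>) y \<partial>M)"
    using int xy z t X by (intro integral_mono) (auto intro!: convex_onD[OF \<phi>])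
  also have "\<dots> = (1 - t) * (\<integral>\<omega>. \<phi> (X 1 \<omega>) x \<partial>M) + t * (\<integral>\<omega>. \<phi> (X 1 \<omega>) y \<partial>M)"
    using int xy by simp
  finally show "population_risk M X \<phi> ?z \<le> (1 - t) * population_risk M X \<phi> x + t * population_risk M X \<phi> y"
    by (simp add: population_risk_def)
qed (rule U)

context prob_space
begin

text \<open>Shifting the index matches samples numbered from \<open>1\<close> with the strong law, whose sequences
  start at \<open>0\<close>. Grouping the variables into singleton blocks allows the re-indexing.\<close>

lemma indep_vars_Suc:
  assumes "indep_vars (\<lambda>_. N) X {1::nat..}"
  shows "indep_vars (\<lambda>_. N) (\<lambda>i. X (Suc i)) UNIV"
proof -
  have "indep_vars (\<lambda>j. Pi\<^sub>M {Suc j} (\<lambda>_. N)) (\<lambda>j \<omega>. restrict (\<lambda>i. X i \<omega>) {Suc j}) UNIV"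
    by (rule indep_vars_restrict[OF assms]) (auto simp: disjoint_family_on_def)
  then have "indep_vars (\<lambda>_. N) (\<lambda>j \<omega>. restrict (\<lambda>i. X i \<omega>) {Suc j} (Suc j)) UNIV"
    by (rule indep_vars_compose2) (auto intro!: measurable_component_singleton)
  then show ?thesis
    by simp
qed

lemma AE_empirical_risk_tendsto:
  assumes iid: "iid_with_law M E P X"
    and meas: "(\<lambda>x. \<phi> x \<theta>) \<in> borel_measurable E"
    and int: "integrable P (\<lambda>x. \<phi> x \<theta>)"
  shows "AE \<omega> in M. (\<lambda>n. empirical_risk X \<phi> n \<omega> \<theta>) \<longlonglongrightarrow> population_risk M X \<phi> \<theta>"
proof -
  have indep: "indep_vars (\<lambda>_. E) (\<lambda>i. X (Suc i)) UNIV"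
    and law: "distr M E (X (Suc i)) = P" for i
    using iid indep_vars_Suc[of E X] by (auto simp: iid_with_law_def)
  have rv: "random_variable E (X (Suc i))" for i
    using indep by (auto simp: indep_vars_def)
  have "distr M borel (\<lambda>\<omega>. \<phi> (X (Suc i) \<omega>) \<theta>) = distr P borel (\<lambda>x. \<phi> x \<theta>)" for i
    using distr_distr[OF meas rv, of i] by (simp add: law comp_def)
  moreover have "integrable M (\<lambda>\<omega>. \<phi> (X (Suc 0) \<omega>) \<theta>)"
    using int integrable_distr_eq[OF rv[of 0] meas] unfolding law by simp
  ultimately have "AE \<omega> in M. (\<lambda>n. (\<Sum>i<n. \<phi> (X (Suc i) \<omega>) \<theta>) / real n)
      \<longlonglongrightarrow> expectation (\<lambda>\<omega>. \<phi> (X (Suc 0) \<omega>) \<theta>)"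
    using indep_vars_compose2[OF indep, of "\<lambda>_ x. \<phi> x \<theta>" "\<lambda>_. borel"] meas
    by (intro strong_law_of_large_numbers) auto
  then show ?thesis
    by (simp add: empirical_risk_def population_risk_def sum.atLeast1_atMost_eq)
qed

end

section \<open>Consistency of convex M-estimators\<close>

theorem theorem4:
  fixes M :: "'w measure"
    and E P :: "'e measure"
    and X :: "nat \<Rightarrow> 'w \<Rightarrow> 'e"
    and \<Theta>\<^sub>0 \<Theta> :: "(real ^ 'd) set"
    and \<phi> :: "'e \<Rightarrow> real ^ 'd \<Rightarrow> real"
    and \<theta>hat :: "nat \<Rightarrow> 'w \<Rightarrow> real ^ 'd"
  assumes "prob_space M"
    and "iid_with_law M E P X"
    and "open \<Theta>\<^sub>0" and "convex \<Theta>\<^sub>0"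
    and "closedin (top_of_set \<Theta>\<^sub>0) \<Theta>" and "convex \<Theta>"
    and "\<And>\<theta>. \<theta> \<in> \<Theta>\<^sub>0 \<Longrightarrow> (\<lambda>x. \<phi> x \<theta>) \<in> borel_measurable E"
    and "\<And>x. x \<in> space E \<Longrightarrow> convex_on \<Theta>\<^sub>0 (\<phi> x)"
    and "\<And>\<theta>. \<theta> \<in> \<Theta>\<^sub>0 \<Longrightarrow> integrable P (\<lambda>x. \<phi> x \<theta>)"
    and "compact (argmin_on (population_risk M X \<phi>) \<Theta>)"
    and "argmin_on (population_risk M X \<phi>) \<Theta> \<noteq> {}"
    and "\<And>n. n \<ge> 1 \<Longrightarrow> \<theta>hat n \<in> borel_measurable M"
    and "\<And>n \<omega>. n \<ge> 1 \<Longrightarrow> \<omega> \<in> space M \<Longrightarrow> \<theta>hat n \<omega> \<in> \<Theta>"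
    and "AE \<omega> in M. \<forall>\<^sub>F n in sequentially.
           \<theta>hat n \<omega> \<in> argmin_on (empirical_risk X \<phi> n \<omega>) \<Theta>"
  shows "AE \<omega> in M.
           (\<lambda>n. infdist (\<theta>hat n \<omega>) (argmin_on (population_risk M X \<phi>) \<Theta>)) \<longlonglongrightarrow> 0"
proof -
  interpret prob_space M
    by fact
  let ?g = "population_risk M X \<phi>"
  have rv: "random_variable E (X i)" if "i \<ge> 1" for i
    using assms(2) that by (auto simp: iid_with_law_def indep_vars_def)
  have law: "distr M E (X 1) = P"
    using assms(2) by (simp add: iid_with_law_def)
  have Xsp: "X i \<omega> \<in> space E" if "i \<ge> 1" "\<omega> \<in> space M" for i \<omega>
    using rv that by (auto dest: measurable_space)
  have int: "integrable M (\<lambda>\<omega>. \<phi> (X 1 \<omega>) \<theta>)" if "\<theta> \<in> \<Theta>\<^sub>0" for \<theta>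
    using assms(9)[OF that] integrable_distr_eq[OF rv[of 1] assms(7)[OF that]] unfolding law by simp
  have g: "convex_on \<Theta>\<^sub>0 ?g"
    using Xsp int assms(4,8) by (intro convex_on_population_risk[where S = "space E"]) auto
  obtain D where D: "countable D" "D \<subseteq> \<Theta>\<^sub>0"
    "\<And>V. open V \<Longrightarrow> V \<inter> \<Theta>\<^sub>0 \<noteq> {} \<Longrightarrow> V \<inter> D \<noteq> {}"
    "\<And>z. z \<in> \<Theta>\<^sub>0 \<Longrightarrow> \<exists>S\<subseteq>D. finite S \<and> z \<in> interior (convex hull S)"
    using countable_locally_spanning_dense_subset[OF assms(3)] by metis
  obtain \<theta>\<^sub>1 where \<theta>\<^sub>1: "\<theta>\<^sub>1 \<in> argmin_on ?g \<Theta>"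
    using assms(11) by blast
  have "\<theta>\<^sub>1 \<in> \<Theta>\<^sub>0"
    using \<theta>\<^sub>1 closedin_subset[OF assms(5)] by (auto simp: mem_argmin_on_iff)
  have slln: "AE \<omega> in M. (\<lambda>n. empirical_risk X \<phi> n \<omega> \<theta>) \<longlonglongrightarrow> ?g \<theta>" if "\<theta> \<in> \<Theta>\<^sub>0" for \<theta>
    using assms(2) assms(7)[OF that] assms(9)[OF that] by (rule AE_empirical_risk_tendsto)
  have "AE \<omega> in M. \<forall>\<theta>\<in>D. (\<lambda>n. empirical_risk X \<phi> n \<omega> \<theta>) \<longlonglongrightarrow> ?g \<theta>"
    using D(2) slln by (intro AE_ball_countable[THEN iffD2] D(1)) auto
  with slln[OF \<open>\<theta>\<^sub>1 \<in> \<Theta>\<^sub>0\<close>] assms(14) AE_space show ?thesis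
  proof eventually_elim
    case (elim \<omega>)
    have "convex_on \<Theta>\<^sub>0 (empirical_risk X \<phi> n \<omega>)" for n
      using Xsp elim assms(4,8) by (intro convex_on_empirical_risk[where S = "space E"]) auto
    then show ?case
      using elim
      by (intro convex_argmin_infdist_tendsto[OF assms(3,5,6) _ g D(2-4) _ assms(10) \<theta>\<^sub>1]) auto
  qed
qed

end
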